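(* Let $\mathcal H$ be a real Hilbert space, $p\ge1$, $\mathcal J:\mathcal H\to\mathbb R\cup\{+\infty\}$ absolutely $p$-homogeneous, proper, convex and lower semicontinuous, and let $u$ be the gradient flow of $\mathcal J$ with initial datum $f\in\overline{\mathrm{dom}(\mathcal J)}$, limit $u_\infty$ and extinction time $T_{\mathrm{ex}}$. Then for all $0<t<T_{\mathrm{ex}}$: $$\|u(t)-u_\infty\|^{2-p}\le\|f-u_\infty\|^{2-p}-(2-p)\lambda_1t\quad\text{if }p<2,$$ $$\|u(t)-u_\infty\|^{2}\le\|f-u_\infty\|^{2}\exp(-2\lambda_1t)\quad\text{if }p=2,$$ $$\|u(t)-u_\infty\|^{p-2}\le\frac{1}{\|f-u_\infty\|^{2-p}+(p-2)\lambda_1t}\quad\text{if }p>2.$$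
   Context: $\mathcal J$ is absolutely $p$-homogeneous if $\mathcal J(0)=0$ and $\mathcal J(cu)=|c|^p\mathcal J(u)$ for $c\ne0$; $\mathrm{dom}(\mathcal J)=\{\mathcal J<\infty\}$; $\partial\mathcal J$ is the convex subdifferential. The null space $\mathcal N_{\mathcal J}=\{\mathcal J=0\}$ is a closed linear subspace and $\lambda_1:=\inf_{v\in\mathcal N_{\mathcal J}^\perp\setminus\{0\}}\frac{p\mathcal J(v)}{\|v\|^p}$. The gradient flow with initial datum $f\in\overline{\mathrm{dom}(\mathcal J)}$ is the unique continuous map $u:[0,\infty)\to\mathcal H$ with $u(0)=f$, Lipschitz on $[\delta,\infty)$ for all $\delta>0$, right-differentiable on $(0,\infty)$, with $-\partial_t^+u(t)$ equal to the minimal-norm element of $\partial\mathcal J(u(t))$ for all $t>0$. The limit $u_\infty:=\lim_{t\to\infty}u(t)$ exists and equals the orthogonal projection of $f$ onto $\mathcal N_{\mathcal J}$. The extinction time is $T_{\mathrm{ex}}:=\inf\{t>0:u(t)=u_\infty\}\in[0,\infty]$ with $\inf\emptyset=\infty$. *)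

theory Defs
  imports "HOL-Analysis.Analysis"
begin

text \<open>
  Functionals with values in the reals extended by plus infinity are functions into \<^typ>\<open>ereal\<close>
  for which \<open>proper_functional\<close> excludes the value minus infinity.
\<close>

definition effective_domain :: "('a \<Rightarrow> ereal) \<Rightarrow> 'a set" where
  "effective_domain J = {x. J x < \<infinity>}"

definition proper_functional :: "('a \<Rightarrow> ereal) \<Rightarrow> bool" where
  "proper_functional J \<longleftrightarrow> (\<forall>x. J x \<noteq> -\<infinity>) \<and> effective_domain J \<noteq> {}"

definition convex_functional :: "('a::real_vector \<Rightarrow> ereal) \<Rightarrow> bool" where
  "convex_functional J \<longleftrightarrow>
     (\<forall>x y s. 0 \<le> s \<and> s \<le> 1 \<longrightarrow>
        J ((1 - s) *\<^sub>R x + s *\<^sub>R y) \<le> ereal (1 - s) * J x + ereal s * J y)"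

definition lower_semicontinuous :: "('a::topological_space \<Rightarrow> ereal) \<Rightarrow> bool" where
  "lower_semicontinuous J \<longleftrightarrow> (\<forall>x. J x \<le> Liminf (at x) J)"

definition absolutely_homogeneous :: "real \<Rightarrow> ('a::real_vector \<Rightarrow> ereal) \<Rightarrow> bool" where
  "absolutely_homogeneous p J \<longleftrightarrow>
     J 0 = 0 \<and> (\<forall>c x. c \<noteq> 0 \<longrightarrow> J (c *\<^sub>R x) = ereal (\<bar>c\<bar> powr p) * J x)"

text \<open>For proper \<open>J\<close> this is empty at points where \<open>J\<close> is infinite.\<close>

definition subdifferential :: "('a::real_inner \<Rightarrow> ereal) \<Rightarrow> 'a \<Rightarrow> 'a set" where
  "subdifferential J x = {\<zeta>. \<forall>y. J x + ereal (\<zeta> \<bullet> (y - x)) \<le> J y}"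

definition null_space :: "('a \<Rightarrow> ereal) \<Rightarrow> 'a set" where
  "null_space J = {x. J x = 0}"

text \<open>
  The infimum is taken in \<^typ>\<open>ereal\<close>; it is infinite if \<open>J\<close> is infinite on all
  nonzero vectors orthogonal to its null space, or if there are no such vectors.
\<close>

definition first_eigenvalue :: "real \<Rightarrow> ('a::real_inner \<Rightarrow> ereal) \<Rightarrow> ereal" where
  "first_eigenvalue p J =
     (INF v \<in> (null_space J)\<^sup>\<bottom> - {0}. ereal p * J v / ereal (norm v powr p))"

definition gradient_flow :: "('a::real_inner \<Rightarrow> ereal) \<Rightarrow> 'a \<Rightarrow> (real \<Rightarrow> 'a) \<Rightarrow> bool" where
  "gradient_flow J f u \<longleftrightarrow>
     u 0 = f \<and>
     continuous_on {0..} u \<and>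
     (\<forall>\<delta>>0. \<exists>L. L-lipschitz_on {\<delta>..} u) \<and>
     (\<forall>t>0. \<exists>d. (u has_vector_derivative d) (at t within {t..}) \<and>
        is_arg_min norm (\<lambda>\<zeta>. \<zeta> \<in> subdifferential J (u t)) (- d))"

definition flow_limit :: "(real \<Rightarrow> 'a::t2_space) \<Rightarrow> 'a" where
  "flow_limit u = Lim at_top u"

definition extinction_time :: "(real \<Rightarrow> 'a::t2_space) \<Rightarrow> ereal" where
  "extinction_time u = Inf {ereal t |t. 0 < t \<and> u t = flow_limit u}"

text \<open>Since \<open>first_eigenvalue\<close> may be infinite, exponential decay needs the extension of \<^const>\<open>exp\<close>.\<close>

definition exp_ereal :: "ereal \<Rightarrow> ereal" where
  "exp_ereal x = (case x of ereal r \<Rightarrow> ereal (exp r) | PInfty \<Rightarrow> \<infinity> | MInfty \<Rightarrow> 0)"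

end

theory Submission
  imports Defs
begin

text \<open>
  Let \<open>w t = u t - flow_limit u\<close> be the displacement from the limit and \<open>\<zeta> t\<close> the subgradient with
  \<open>u' = - \<zeta>\<close>. Homogeneity gives Euler's identity \<open>\<zeta> t \<bullet> u t = p * J (u t)\<close>, and subgradients are
  orthogonal to the null space of \<open>J\<close>. Once the limit is known to lie in the null space and \<open>w t\<close>
  to be orthogonal to it, it follows that \<open>\<zeta> t \<bullet> w t = p * J (u t)\<close>, which is at least
  \<open>p * J (w t)\<close>, hence at least \<open>\<lambda>\<^sub>1 * norm (w t) powr p\<close> by definition of the first
  eigenvalue \<open>\<lambda>\<^sub>1\<close>. So \<open>y t = (norm (w t))\<^sup>2\<close> has right derivative at most
  \<open>- 2 * \<lambda>\<^sub>1 * y t powr (p / 2)\<close>, and separation of variables gives the three decay laws at once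
  (\<open>decay_potential_estimate\<close>). Before extinction \<open>w\<close> does not vanish, which makes \<open>\<lambda>\<^sub>1\<close> finite and
  keeps \<open>y\<close> in the domain of the separated equation.

  The remaining work is the existence and the position of the limit. The functional is even, and
  for even functionals Bruck's estimate (\<open>bruck_estimate\<close>) bounds \<open>(norm (u s - u t))\<^sup>2\<close> by twice
  the decrease of the squared norm between \<open>s\<close> and \<open>t\<close>, so that \<open>u\<close> is Cauchy. The estimate needs that the energy
  \<open>J (u t)\<close> does not increase (\<open>energy_nonincreasing\<close>). To see this, note that
  arbitrarily short forward steps with almost no growth of the energy exist, because
  later subgradients cannot all point against the present one (\<open>subgradients_not_opposite\<close>).
  Euler's identity makes the decrease of the squared norm proportional to the energy, which therefore
  tends to zero; by lower semicontinuity the limit lies in the null space. The components of \<open>u\<close>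
  along null vectors are conserved, so \<open>w t\<close> is orthogonal to the null space.
\<close>

section \<open>Monotonicity from one-sided information\<close>

text \<open>
  Walk from \<open>a\<close> to the right as long as \<open>g\<close> stays below a line of small slope \<open>e\<close>. The reached
  points form a compact set, and a good step from its largest element would lead further, so the
  walk ends at \<open>b\<close>. The hypothesis provides single good steps because this is the form in which
  information on the energy along the flow becomes available.
\<close>
lemma nonincreasing_if_forward_steps:
  fixes g :: "real \<Rightarrow> real"
  assumes "a \<le> b"
    and cont: "continuous_on {a..b} g"
    and step: "\<And>x e. a < x \<Longrightarrow> x < b \<Longrightarrow> 0 < e \<Longrightarrow> \<exists>y>x. y \<le> b \<and> g y \<le> g x + e * (y - x)"
  shows "g b \<le> g a"
proof (cases "a = b")
  case False
  with assms(1) have "a < b" by simp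
  have bound: "g b \<le> g a + e * (b - a + 1)" if "0 < e" for e
  proof -
    \<comment> \<open>The extra height \<open>e\<close> covers the left end point, where no step is given: by continuity of \<open>g\<close>
      it lets the walk leave \<open>a\<close>.\<close>
    define S where "S = {x \<in> {a..b}. g x - e * (x - a) \<le> g a + e}"
    have contd: "continuous_on {a..b} (\<lambda>x. g x - e * (x - a))"
      by (intro continuous_intros cont)
    have "closed S"
      unfolding S_def by (rule continuous_on_closed_Collect_le[OF contd]) (auto intro: continuous_intros)
    moreover have "bounded S"
      by (rule bounded_subset[of "{a..b}"]) (auto simp: S_def)
    ultimately have "compact S"
      by (simp add: compact_eq_bounded_closed)
    moreover have "a \<in> S"
      using \<open>a < b\<close> \<open>0 < e\<close> by (simp add: S_def)
    ultimately obtain x where x: "x \<in> S" and x_max: "\<And>y. y \<in> S \<Longrightarrow> y \<le> x"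
      using compact_attains_sup[of S] by blast
    have "a < x"
    proof -
      obtain d where "d > 0" and d: "\<And>y. y \<in> {a..b} \<Longrightarrow> dist y a < d \<Longrightarrow> dist (g y) (g a) < e"
        using cont \<open>a < b\<close> \<open>0 < e\<close> unfolding continuous_on_iff
        by (metis atLeastAtMost_iff less_eq_real_def)
      define y where "y = min b (a + d / 2)"
      have y: "a < y" "y \<le> b" "dist y a < d"
        using \<open>a < b\<close> \<open>d > 0\<close> by (auto simp: y_def dist_real_def)
      then have "g y < g a + e"
        using d[of y] by (auto simp: dist_real_def)
      moreover have "0 \<le> e * (y - a)"
        using \<open>0 < e\<close> y by simp
      ultimately have "y \<in> S"
        using y by (simp add: S_def)
      then show ?thesis
        using x_max[of y] y by simp
    qed
    have "x = b"
    proof (rule ccontr)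
      assume "x \<noteq> b"
      with x have "x < b" by (auto simp: S_def)
      from step[OF \<open>a < x\<close> this \<open>0 < e\<close>] obtain y
        where y: "x < y" "y \<le> b" "g y \<le> g x + e * (y - x)" by blast
      then have "y \<in> S"
        using x by (auto simp: S_def algebra_simps)
      then show False
        using x_max y(1) by fastforce
    qed
    with x show ?thesis
      by (simp add: S_def algebra_simps)
  qed
  show ?thesis
  proof (rule field_le_epsilon)
    fix e :: real assume "0 < e"
    then show "g b \<le> g a + e"
      using bound[of "e / (b - a + 1)"] \<open>a < b\<close> by simp
  qed
qed simp

lemma nonincreasing_if_right_derivative_nonpos:
  fixes g :: "real \<Rightarrow> real"
  assumes "a \<le> b"
    and "continuous_on {a..b} g"
    and deriv: "\<And>x. a < x \<Longrightarrow> x < b \<Longrightarrow> \<exists>D\<le>0. (g has_real_derivative D) (at x within {x..})"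
  shows "g b \<le> g a"
proof (rule nonincreasing_if_forward_steps[OF assms(1,2)])
  fix x e :: real
  assume x: "a < x" "x < b" and "0 < e"
  from deriv[OF x] obtain D where "D \<le> 0" and "(g has_real_derivative D) (at x within {x..})"
    by blast
  then have "((\<lambda>y. (g y - g x) / (y - x)) \<longlongrightarrow> D) (at_right x)"
    by (simp add: has_field_derivative_iff at_within_Ici_at_right)
  then have "eventually (\<lambda>y. (g y - g x) / (y - x) < e) (at_right x)"
    by (rule order_tendstoD) (use \<open>D \<le> 0\<close> \<open>0 < e\<close> in simp)
  moreover have "eventually (\<lambda>y. x < y \<and> y < b) (at_right x)"
    using eventually_at_right_real[OF x(2)] by eventually_elim auto
  ultimately have "eventually (\<lambda>y. x < y \<and> y \<le> b \<and> g y \<le> g x + e * (y - x)) (at_right x)"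
    by eventually_elim (auto simp: field_simps)
  then show "\<exists>y>x. y \<le> b \<and> g y \<le> g x + e * (y - x)"
    using eventually_happens'[OF trivial_limit_at_right_real] by blast
qed

text \<open>
  The lower limit in the definition is taken over punctured neighbourhoods; adding the centre makes
  the estimate usable along curves that may pass through the limit point.
\<close>
lemma lower_semicontinuous_eventually_greater:
  assumes "lower_semicontinuous J" "c < J x"
  shows "eventually (\<lambda>y. c < J y) (nhds x)"
proof -
  have "c < Liminf (at x) J"
    using assms unfolding lower_semicontinuous_def by (meson less_le_trans)
  then have "eventually (\<lambda>y. c < J y) (at x)"
    by (rule less_LiminfD)
  then have "eventually (\<lambda>y. y \<noteq> x \<longrightarrow> c < J y) (nhds x)"
    by (simp add: eventually_at_filter)
  then show ?thesis
    by eventually_elim (use assms(2) in auto)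
qed

section \<open>Subgradients of homogeneous convex functionals\<close>

locale homogeneous_convex_functional =
  fixes p :: real and J :: "'a::real_inner \<Rightarrow> ereal"
  assumes p_ge_1: "1 \<le> p"
    and homogeneous: "absolutely_homogeneous p J"
    and proper: "proper_functional J"
    and convex: "convex_functional J"
begin

lemma J_zero: "J 0 = 0"
  using homogeneous by (simp add: absolutely_homogeneous_def)

lemma J_scaleR: "c \<noteq> 0 \<Longrightarrow> J (c *\<^sub>R x) = ereal (\<bar>c\<bar> powr p) * J x"
  using homogeneous by (simp add: absolutely_homogeneous_def)

lemma J_minus: "J (- x) = J x"
  using J_scaleR[of "-1" x] by simp

lemma convexD:
  "0 \<le> s \<Longrightarrow> s \<le> 1 \<Longrightarrow> J ((1 - s) *\<^sub>R x + s *\<^sub>R y) \<le> ereal (1 - s) * J x + ereal s * J y"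
  using convex by (simp add: convex_functional_def)

text \<open>Convexity bounds \<open>J 0 = 0\<close> by the mean of \<open>J x\<close> and \<open>J (- x) = J x\<close>.\<close>
lemma J_nonneg: "0 \<le> J x"
proof -
  have "J ((1 - 1/2) *\<^sub>R x + (1/2) *\<^sub>R (- x)) \<le> ereal (1 - 1/2) * J x + ereal (1/2) * J (- x)"
    by (rule convexD) auto
  then have "0 \<le> ereal (1/2) * J x + ereal (1/2) * J x"
    by (simp add: J_zero J_minus)
  then show ?thesis
    by (cases "J x") auto
qed

lemma J_finite_if_less_infinity:
  assumes "J x < \<infinity>"
  obtains r where "J x = ereal r" "0 \<le> r"
  using assms J_nonneg[of x] by (cases "J x") auto

text \<open>
  Write \<open>x + n\<close> as the convex combination of \<open>x / (1 - s)\<close> and \<open>n / s\<close>. The second point still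
  has value zero however small \<open>s\<close> is, while the first tends to \<open>x\<close> and its value to \<open>J x\<close>.
\<close>
lemma J_add_null_le:
  assumes "J n = 0"
  shows "J (x + n) \<le> J x"
proof (cases "J x < \<infinity>")
  case True
  then obtain r where r: "J x = ereal r" "0 \<le> r"
    by (rule J_finite_if_less_infinity)
  have bound: "J (x + n) \<le> ereal ((1 - s) * ((1 / (1 - s)) powr p * r))" if s: "0 < s" "s < 1" for s
  proof -
    have "J (x + n) = J ((1 - s) *\<^sub>R ((1 / (1 - s)) *\<^sub>R x) + s *\<^sub>R ((1 / s) *\<^sub>R n))"
      using s by simp
    also have "\<dots> \<le> ereal (1 - s) * J ((1 / (1 - s)) *\<^sub>R x) + ereal s * J ((1 / s) *\<^sub>R n)"
      using s by (intro convexD) auto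
    also have "\<dots> = ereal ((1 - s) * ((1 / (1 - s)) powr p * r))"
      using s by (subst (1 2) J_scaleR) (auto simp: assms r)
    finally show ?thesis .
  qed
  have "((\<lambda>s. (1 - s) * ((1 / (1 - s)) powr p * r)) \<longlongrightarrow> (1 - 0) * ((1 / (1 - 0)) powr p * r)) (at_right (0::real))"
    by (intro tendsto_intros) auto
  then have "((\<lambda>s. ereal ((1 - s) * ((1 / (1 - s)) powr p * r))) \<longlongrightarrow> J x) (at_right 0)"
    by (simp add: r)
  moreover have "eventually (\<lambda>s. J (x + n) \<le> ereal ((1 - s) * ((1 / (1 - s)) powr p * r))) (at_right 0)"
    using eventually_at_right_real[of 0 1] by (rule eventually_mono) (auto intro: bound)
  ultimately show ?thesis
    by (rule tendsto_lowerbound) simp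
qed auto

lemma subdifferentialD: "\<zeta> \<in> subdifferential J x \<Longrightarrow> J x + ereal (\<zeta> \<bullet> (y - x)) \<le> J y"
  by (simp add: subdifferential_def)

lemma J_finite_if_subgradient:
  assumes "\<zeta> \<in> subdifferential J x"
  obtains r where "J x = ereal r" "0 \<le> r"
proof -
  have "J x < \<infinity>"
    using subdifferentialD[OF assms, of 0] by (cases "J x") (auto simp: J_zero)
  then show ?thesis
    by (rule J_finite_if_less_infinity) (rule that)
qed

text \<open>
  Moving from \<open>x\<close> along \<open>n\<close> or \<open>- n\<close> does not increase \<open>J\<close>, so the linear minorant given by the
  subgradient cannot increase in either direction.
\<close>
lemma subgradient_orthogonal_null:
  assumes "\<zeta> \<in> subdifferential J x" "J n = 0"
  shows "\<zeta> \<bullet> n = 0"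
proof -
  obtain r where r: "J x = ereal r"
    using assms(1) by (rule J_finite_if_subgradient)
  have le: "\<zeta> \<bullet> m \<le> 0" if "J m = 0" for m
  proof -
    have "J x + ereal (\<zeta> \<bullet> m) \<le> J x"
      using subdifferentialD[OF assms(1), of "x + m"] J_add_null_le[OF that, of x] by simp
    then show ?thesis
      by (simp add: r)
  qed
  from le[of n] le[of "- n"] show ?thesis
    using assms(2) by (simp add: J_minus)
qed

text \<open>
  Along the ray through \<open>x\<close> the gap between \<open>J\<close> and its supporting affine function is
  differentiable and attains its minimum at \<open>x\<close> itself, so its derivative vanishes there.
\<close>
lemma euler_identity:
  assumes "\<zeta> \<in> subdifferential J x"
  shows "\<zeta> \<bullet> x = p * real_of_ereal (J x)"
proof -
  obtain r where r: "J x = ereal r"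
    using assms by (rule J_finite_if_subgradient)
  define h where "h c = c powr p * r - (c - 1) * (\<zeta> \<bullet> x)" for c
  have "(h has_real_derivative p * r - \<zeta> \<bullet> x) (at 1)"
    unfolding h_def by (auto intro!: derivative_eq_intros)
  moreover have "h 1 \<le> h c" if "\<bar>1 - c\<bar> < 1" for c
  proof -
    have "J x + ereal (\<zeta> \<bullet> (c *\<^sub>R x - x)) \<le> J (c *\<^sub>R x)"
      by (rule subdifferentialD[OF assms])
    also have "J (c *\<^sub>R x) = ereal (c powr p * r)"
      using that by (subst J_scaleR) (auto simp: r)
    finally show ?thesis
      by (simp add: r h_def inner_diff_right algebra_simps)
  qed
  ultimately have "p * r - \<zeta> \<bullet> x = 0"
    using DERIV_local_min[of h "p * r - \<zeta> \<bullet> x" 1 1] by auto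
  then show ?thesis
    by (simp add: r)
qed

end

section \<open>Energy and norm along the flow\<close>

lemma has_real_derivative_inner:
  fixes a b :: "real \<Rightarrow> 'a::real_inner"
  assumes "(a has_vector_derivative a') (at x within S)" "(b has_vector_derivative b') (at x within S)"
  shows "((\<lambda>t. a t \<bullet> b t) has_real_derivative (a x \<bullet> b' + a' \<bullet> b x)) (at x within S)"
proof -
  have "((\<lambda>t. a t \<bullet> b t) has_derivative (\<lambda>h. a x \<bullet> (h *\<^sub>R b') + (h *\<^sub>R a') \<bullet> b x)) (at x within S)"
    using assms unfolding has_vector_derivative_def by (rule has_derivative_inner)
  moreover have "(\<lambda>h. a x \<bullet> (h *\<^sub>R b') + (h *\<^sub>R a') \<bullet> b x) = (*) (a x \<bullet> b' + a' \<bullet> b x)"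
    by (auto simp: fun_eq_iff algebra_simps)
  ultimately show ?thesis
    by (simp add: has_field_derivative_def)
qed

lemma right_vector_derivative_tendsto:
  assumes "(v has_vector_derivative d) (at t within {t..})"
  shows "((\<lambda>y. (1 / (y - t)) *\<^sub>R (v y - v t)) \<longlongrightarrow> d) (at_right t)"
proof -
  have "((\<lambda>y. (1 / norm (y - t)) *\<^sub>R (v y - (v t + (y - t) *\<^sub>R d))) \<longlongrightarrow> 0) (at_right t)"
    using assms by (simp add: has_vector_derivative_def has_derivative_within at_within_Ici_at_right)
  moreover have "eventually (\<lambda>y. (1 / norm (y - t)) *\<^sub>R (v y - (v t + (y - t) *\<^sub>R d))
      = (1 / (y - t)) *\<^sub>R (v y - v t) - d) (at_right t)"
    using eventually_at_right_less[of t]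
    by eventually_elim (simp add: algebra_simps flip: scaleR_diff_left scaleR_add_left)
  ultimately have "((\<lambda>y. (1 / (y - t)) *\<^sub>R (v y - v t) - d) \<longlongrightarrow> 0) (at_right t)"
    by (rule Lim_transform_eventually)
  then show ?thesis
    by (subst Lim_null)
qed

text \<open>
  The flow as a differential inclusion. Fixing the selection \<open>\<zeta>\<close> of the subgradients that drive it
  gives the right derivative of \<open>u\<close> a name.
\<close>
locale homogeneous_gradient_flow = homogeneous_convex_functional p J
  for p :: real and J :: "'a::{real_inner, complete_space} \<Rightarrow> ereal" +
  fixes u \<zeta> :: "real \<Rightarrow> 'a"
  assumes lower_semicontinuous: "lower_semicontinuous J"
    and continuous: "continuous_on {0..} u"
    and lipschitz: "\<And>\<delta>. 0 < \<delta> \<Longrightarrow> \<exists>L. L-lipschitz_on {\<delta>..} u"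
    and subgradient: "\<And>t. 0 < t \<Longrightarrow> \<zeta> t \<in> subdifferential J (u t)"
    and velocity: "\<And>t. 0 < t \<Longrightarrow> (u has_vector_derivative - \<zeta> t) (at t within {t..})"
begin

definition energy :: "real \<Rightarrow> real" where
  "energy t = real_of_ereal (J (u t))"

lemma J_flow:
  assumes "0 < t"
  shows "J (u t) = ereal (energy t)"
  using J_finite_if_subgradient[OF subgradient[OF assms]] by (metis energy_def real_of_ereal.simps(1))

lemma energy_nonneg: "0 < t \<Longrightarrow> 0 \<le> energy t"
  using J_nonneg[of "u t"] by (simp add: J_flow)

lemma energy_slope: "0 < s \<Longrightarrow> 0 < t \<Longrightarrow> energy s + \<zeta> s \<bullet> (u t - u s) \<le> energy t"
  using subdifferentialD[OF subgradient, of s "u t"] by (simp add: J_flow)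

lemma flow_inner_subgradient: "0 < t \<Longrightarrow> \<zeta> t \<bullet> u t = p * energy t"
  by (simp add: energy_def euler_identity subgradient)

lemma continuous_flow: "0 \<le> a \<Longrightarrow> continuous_on {a..b} u"
  by (rule continuous_on_subset[OF continuous]) auto

lemma lipschitz_norm_bound:
  assumes "L-lipschitz_on {\<delta>..} u" "0 < \<delta>" "\<delta> \<le> t"
  shows "norm (\<zeta> t) \<le> L"
proof -
  have "((\<lambda>y. norm ((1 / (y - t)) *\<^sub>R (u y - u t))) \<longlongrightarrow> norm (- \<zeta> t)) (at_right t)"
    using assms by (intro tendsto_norm right_vector_derivative_tendsto velocity) auto
  moreover have "eventually (\<lambda>y. norm ((1 / (y - t)) *\<^sub>R (u y - u t)) \<le> L) (at_right t)"
    using eventually_at_right_less[of t]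
  proof eventually_elim
    case (elim y)
    then have "dist (u y) (u t) \<le> L * dist y t"
      using assms by (intro lipschitz_onD[OF assms(1)]) auto
    with elim show ?case
      by (simp add: dist_norm divide_simps)
  qed
  ultimately have "norm (- \<zeta> t) \<le> L"
    by (rule tendsto_upperbound) simp
  then show ?thesis by simp
qed

text \<open>
  The subgradient inequality at \<open>s\<close> bounds \<open>energy s - energy t\<close> by an inner product of \<open>\<zeta> s\<close> with
  \<open>u s - u t\<close>, and the Lipschitz constant of \<open>u\<close> controls both factors.
\<close>
lemma energy_lipschitz:
  assumes "L-lipschitz_on {\<delta>..} u" "0 < \<delta>"
  shows "(L * L)-lipschitz_on {\<delta>..} energy"
proof (rule lipschitz_onI)
  have "0 \<le> L"
    using assms(1) by (rule lipschitz_on_nonneg)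
  then show "0 \<le> L * L" by simp
  have le: "energy s - energy t \<le> L * L * dist s t" if "s \<in> {\<delta>..}" "t \<in> {\<delta>..}" for s t
  proof -
    have "energy s - energy t \<le> \<zeta> s \<bullet> (u s - u t)"
      using energy_slope[of s t] that \<open>0 < \<delta>\<close> by (simp add: inner_diff_right)
    also have "\<dots> \<le> norm (\<zeta> s) * norm (u s - u t)"
      by (rule norm_cauchy_schwarz)
    also have "\<dots> \<le> L * (L * dist s t)"
      using that lipschitz_norm_bound[OF assms, of s] lipschitz_onD[OF assms(1), of s t] \<open>0 \<le> L\<close>
      by (intro mult_mono) (auto simp: dist_norm)
    finally show ?thesis by simp
  qed
  fix s t assume "s \<in> {\<delta>..}" "t \<in> {\<delta>..}"
  with le[of s t] le[of t s] show "dist (energy s) (energy t) \<le> L * L * dist s t"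
    by (simp add: dist_real_def abs_minus_commute)
qed

text \<open>
  If all subgradients between \<open>s\<close> and \<open>b\<close> had negative inner product with \<open>\<zeta> s\<close>, then \<open>u\<close> would
  advance in the direction of \<open>\<zeta> s\<close>. As its velocity at time \<open>s\<close> is \<open>- \<zeta> s\<close>, this forces \<open>\<zeta> s = 0\<close>,
  and then no inner product with \<open>\<zeta> s\<close> is negative. The lemma takes the
  place of right continuity of \<open>\<zeta>\<close> in the proof that the energy does not increase.
\<close>
lemma subgradients_not_opposite:
  assumes "0 < s" "s < b"
  shows "\<exists>\<tau>. s < \<tau> \<and> \<tau> < b \<and> 0 \<le> \<zeta> \<tau> \<bullet> \<zeta> s"
proof (rule ccontr)
  assume "\<not> ?thesis"
  then have neg: "\<zeta> \<tau> \<bullet> \<zeta> s < 0" if "s < \<tau>" "\<tau> < b" for \<tau>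
    using that by force
  have deriv: "((\<lambda>y. - (u y \<bullet> \<zeta> s)) has_real_derivative \<zeta> y \<bullet> \<zeta> s) (at y within {y..})" if "0 < y" for y
    using DERIV_minus[OF has_real_derivative_inner[OF velocity[OF that] has_vector_derivative_const[of "\<zeta> s"]]]
    by simp
  have "u s \<bullet> \<zeta> s \<le> u y \<bullet> \<zeta> s" if y: "s < y" "y < b" for y
  proof -
    have "- (u y \<bullet> \<zeta> s) \<le> - (u s \<bullet> \<zeta> s)"
    proof (rule nonincreasing_if_right_derivative_nonpos[where g = "\<lambda>y. - (u y \<bullet> \<zeta> s)"])
      show "continuous_on {s..y} (\<lambda>y. - (u y \<bullet> \<zeta> s))"
        using assms by (intro continuous_intros continuous_flow) auto
      show "\<exists>D\<le>0. ((\<lambda>y. - (u y \<bullet> \<zeta> s)) has_real_derivative D) (at x within {x..})"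
        if "s < x" "x < y" for x
        using deriv[of x] neg[of x] that y assms by (intro exI[of _ "\<zeta> x \<bullet> \<zeta> s"]) auto
    qed (use y in auto)
    then show ?thesis by simp
  qed
  then have "eventually (\<lambda>y. 0 \<le> ((1 / (y - s)) *\<^sub>R (u y - u s)) \<bullet> \<zeta> s) (at_right s)"
    using eventually_at_right_real[OF assms(2)]
    by (auto elim!: eventually_mono simp: inner_diff_left)
  moreover have "((\<lambda>y. ((1 / (y - s)) *\<^sub>R (u y - u s)) \<bullet> \<zeta> s) \<longlongrightarrow> (- \<zeta> s) \<bullet> \<zeta> s) (at_right s)"
    using assms by (intro tendsto_inner right_vector_derivative_tendsto velocity tendsto_const) auto
  ultimately have "0 \<le> (- \<zeta> s) \<bullet> \<zeta> s"
    by (intro tendsto_lowerbound) auto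
  then have "\<zeta> s = 0"
    by (metis inner_minus_left neg_0_le_iff_le inner_ge_zero inner_eq_zero_iff order_antisym)
  then show False
    using neg[of "(s + b) / 2"] assms by simp
qed

text \<open>
  The subgradient inequality at the later time \<open>y\<close> gives
  \<open>energy y - energy x \<le> \<zeta> y \<bullet> (u y - u x)\<close>, where \<open>u y - u x\<close> is close to \<open>- (y - x) *\<^sub>R \<zeta> x\<close>. The
  inner product of \<open>\<zeta> y\<close> and \<open>\<zeta> x\<close> can be made nonnegative for \<open>y\<close> arbitrarily close to \<open>x\<close>, and
  such steps suffice for monotonicity.
\<close>
lemma energy_nonincreasing:
  assumes "0 < s" "s \<le> t"
  shows "energy t \<le> energy s"
proof -
  obtain L where L: "L-lipschitz_on {s..} u"
    using lipschitz[OF \<open>0 < s\<close>] by blast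
  then have "0 \<le> L" by (rule lipschitz_on_nonneg)
  have "continuous_on {s..} energy"
    using lipschitz_on_continuous_on[OF energy_lipschitz[OF L \<open>0 < s\<close>]] .
  then have "continuous_on {s..t} energy"
    by (rule continuous_on_subset) auto
  then show ?thesis
  proof (rule nonincreasing_if_forward_steps[OF \<open>s \<le> t\<close>])
    fix x e :: real
    assume x: "s < x" "x < t" and "0 < e"
    with \<open>0 < s\<close> have "0 < x" by simp
    have "((\<lambda>y. (1 / (y - x)) *\<^sub>R (u y - u x)) \<longlongrightarrow> - \<zeta> x) (at_right x)"
      by (intro right_vector_derivative_tendsto velocity \<open>0 < x\<close>)
    then have "eventually (\<lambda>y. dist ((1 / (y - x)) *\<^sub>R (u y - u x)) (- \<zeta> x) < e / (L + 1)) (at_right x)"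
      using \<open>0 < e\<close> \<open>0 \<le> L\<close> by (intro tendstoD) auto
    then obtain b where "x < b"
      and b: "\<And>y. x < y \<Longrightarrow> y < b \<Longrightarrow> dist ((1 / (y - x)) *\<^sub>R (u y - u x)) (- \<zeta> x) < e / (L + 1)"
      by (auto simp: eventually_at_right_field)
    obtain y where y: "x < y" "y < min b t" "0 \<le> \<zeta> y \<bullet> \<zeta> x"
      using subgradients_not_opposite[OF \<open>0 < x\<close>, of "min b t"] \<open>x < b\<close> x(2) by auto
    define r where "r = (1 / (y - x)) *\<^sub>R (u y - u x) + \<zeta> x"
    have "norm r \<le> e / (L + 1)"
      using b[of y] y by (simp add: r_def dist_norm)
    have "u y - u x = (y - x) *\<^sub>R (r - \<zeta> x)"
      using y(1) by (simp add: r_def)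
    moreover have "\<zeta> y \<bullet> (r - \<zeta> x) \<le> e"
    proof -
      have "\<zeta> y \<bullet> r \<le> norm (\<zeta> y) * norm r"
        by (rule norm_cauchy_schwarz)
      also have "\<dots> \<le> L * (e / (L + 1))"
        using lipschitz_norm_bound[OF L \<open>0 < s\<close>, of y] x y \<open>norm r \<le> _\<close> \<open>0 \<le> L\<close>
        by (intro mult_mono) auto
      also have "\<dots> \<le> e"
        using \<open>0 \<le> L\<close> \<open>0 < e\<close> by (simp add: field_simps)
      finally show ?thesis
        using y(3) by (simp add: inner_diff_right)
    qed
    ultimately have "\<zeta> y \<bullet> (u y - u x) \<le> e * (y - x)"
      using y(1) by (simp add: mult.commute[of e] mult_left_mono)
    moreover have "energy y \<le> energy x + \<zeta> y \<bullet> (u y - u x)"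
      using energy_slope[of y x] y(1) \<open>0 < x\<close> by (simp add: inner_diff_right)
    ultimately show "\<exists>y>x. y \<le> t \<and> energy y \<le> energy x + e * (y - x)"
      using y by (intro exI[of _ y]) auto
  qed
qed

lemma has_real_derivative_norm_square:
  assumes "0 < t"
  shows "((\<lambda>s. (norm (u s - a))\<^sup>2) has_real_derivative - 2 * (\<zeta> t \<bullet> (u t - a))) (at t within {t..})"
proof -
  have "((\<lambda>s. u s - a) has_vector_derivative - \<zeta> t - 0) (at t within {t..})"
    by (intro has_vector_derivative_diff velocity has_vector_derivative_const assms)
  from has_real_derivative_inner[OF this this] show ?thesis
    by (simp add: power2_norm_eq_inner inner_commute)
qed

text \<open>
  By Euler's identity the squared norm decreases at rate \<open>2 * p * energy\<close>, which up to time \<open>t\<close> is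
  at least its value at \<open>t\<close>.
\<close>
lemma norm_square_decrease:
  assumes "0 < s" "s \<le> t"
  shows "(norm (u t))\<^sup>2 + 2 * p * energy t * (t - s) \<le> (norm (u s))\<^sup>2"
proof -
  have "(norm (u t))\<^sup>2 + 2 * p * energy t * t \<le> (norm (u s))\<^sup>2 + 2 * p * energy t * s"
  proof (rule nonincreasing_if_right_derivative_nonpos[OF \<open>s \<le> t\<close>])
    show "continuous_on {s..t} (\<lambda>x. (norm (u x))\<^sup>2 + 2 * p * energy t * x)"
      using assms by (intro continuous_intros continuous_flow) auto
    fix x assume x: "s < x" "x < t"
    then have "0 < x" using assms by simp
    have "((\<lambda>x. (norm (u x))\<^sup>2 + 2 * p * energy t * x) has_real_derivative
        - 2 * (\<zeta> x \<bullet> u x) + 2 * p * energy t) (at x within {x..})"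
      using DERIV_add[OF has_real_derivative_norm_square[OF \<open>0 < x\<close>, of 0]
          DERIV_cmult_Id[of "2 * p * energy t"]]
      by simp
    moreover have "- 2 * (\<zeta> x \<bullet> u x) + 2 * p * energy t \<le> 0"
      using energy_nonincreasing[of x t] x \<open>0 < x\<close> p_ge_1
      by (simp add: flow_inner_subgradient)
    ultimately show "\<exists>D\<le>0. ((\<lambda>x. (norm (u x))\<^sup>2 + 2 * p * energy t * x) has_real_derivative D) (at x within {x..})"
      by blast
  qed
  then show ?thesis
    by (simp add: algebra_simps)
qed

text \<open>
  This is Bruck's argument for even functionals. Testing the subgradient at time \<open>x\<close> with the
  reflected point \<open>- u t\<close>, whose energy is that of \<open>u t\<close> and hence not larger than that of \<open>u x\<close>,
  gives \<open>0 \<le> \<zeta> x \<bullet> (u x + u t)\<close>. Hence the difference of \<open>(norm (u x))\<^sup>2\<close> and half of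
  \<open>(norm (u x - u t))\<^sup>2\<close> does not increase in \<open>x\<close>.
\<close>
lemma bruck_estimate:
  assumes "0 < s" "s \<le> t"
  shows "(norm (u s - u t))\<^sup>2 \<le> 2 * ((norm (u s))\<^sup>2 - (norm (u t))\<^sup>2)"
proof -
  define g where "g x = (norm (u x))\<^sup>2 - (norm (u x - u t))\<^sup>2 / 2" for x
  have "g t \<le> g s"
  proof (rule nonincreasing_if_right_derivative_nonpos[OF \<open>s \<le> t\<close>])
    show "continuous_on {s..t} g"
      unfolding g_def using assms by (intro continuous_intros continuous_flow) auto
    fix x assume x: "s < x" "x < t"
    then have "0 < x" using assms by simp
    have "(g has_real_derivative - (\<zeta> x \<bullet> (u x + u t))) (at x within {x..})"
      unfolding g_def
      by (rule DERIV_cong[OF DERIV_diff[OF has_real_derivative_norm_square[OF \<open>0 < x\<close>, of 0, simplified]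
              DERIV_cdivide[OF has_real_derivative_norm_square[OF \<open>0 < x\<close>, of "u t"], of 2]]])
        (simp add: inner_diff_right inner_add_right field_simps)
    moreover have "- (\<zeta> x \<bullet> (u x + u t)) \<le> 0"
    proof -
      have "energy x + \<zeta> x \<bullet> (- u t - u x) \<le> energy t"
        using subdifferentialD[OF subgradient[OF \<open>0 < x\<close>], of "- u t"] \<open>0 < x\<close> x
        by (simp add: J_flow J_minus)
      then show ?thesis
        using energy_nonincreasing[of x t] x \<open>0 < x\<close> by (simp add: inner_diff_right inner_add_right)
    qed
    ultimately show "\<exists>D\<le>0. (g has_real_derivative D) (at x within {x..})"
      by blast
  qed
  then show ?thesis
    by (simp add: g_def)
qed

section \<open>The limit of the flow\<close>

text \<open>
  The squared norm decreases to its infimum, and Bruck's estimate turns this into the Cauchy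
  property of \<open>u\<close>.
\<close>
lemma flow_converges: "(u \<longlongrightarrow> flow_limit u) at_top"
proof -
  define m where "m = (INF t\<in>{0<..}. (norm (u t))\<^sup>2)"
  have bdd: "bdd_below ((\<lambda>t. (norm (u t))\<^sup>2) ` {0<..})"
    by (rule bdd_belowI2[of _ 0]) auto
  have "cauchy_filter (filtermap u at_top)"
    unfolding cauchy_filter_metric_filtermap
  proof (intro allI impI)
    fix e :: real assume "0 < e"
    define d where "d = (e / 2)\<^sup>2 / 2"
    have "0 < d"
      using \<open>0 < e\<close> by (simp add: d_def)
    then have "m < m + d" by simp
    then obtain s where "0 < s" and s: "(norm (u s))\<^sup>2 < m + d"
      unfolding m_def using cINF_less_iff[OF _ bdd] by (metis greaterThan_iff greaterThan_non_empty)
    have close: "dist (u s) (u t) < e / 2" if "s \<le> t" for t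
    proof -
      have "m \<le> (norm (u t))\<^sup>2"
        unfolding m_def using \<open>0 < s\<close> that by (intro cINF_lower[OF bdd]) auto
      then have "(norm (u s - u t))\<^sup>2 < (e / 2)\<^sup>2"
        using bruck_estimate[OF \<open>0 < s\<close> that] s by (simp add: d_def)
      then have "norm (u s - u t) < e / 2"
        by (rule power_less_imp_less_base) (use \<open>0 < e\<close> in simp)
      then show ?thesis
        by (simp add: dist_norm)
    qed
    show "\<exists>P. eventually P at_top \<and> (\<forall>x y. P x \<and> P y \<longrightarrow> dist (u x) (u y) < e)"
    proof (intro exI[of _ "\<lambda>t. s \<le> t"] conjI allI impI)
      show "dist (u x) (u y) < e" if "s \<le> x \<and> s \<le> y" for x y
        using close[of x] close[of y] that dist_triangle_half_r by metis
    qed (rule eventually_ge_at_top)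
  qed
  then have "convergent_filter (filtermap u at_top)"
    by (rule cauchy_filter_convergent)
  then obtain l where "(u \<longlongrightarrow> l) at_top"
    by (auto simp: convergent_filter.simps filterlim_def)
  moreover from this have "flow_limit u = l"
    unfolding flow_limit_def by (intro tendsto_Lim) auto
  ultimately show ?thesis by simp
qed

text \<open>
  Since the squared norm cannot become negative, its rate of decrease, and with it the energy,
  tends to zero; lower semicontinuity passes this to the limit.
\<close>
lemma J_flow_limit: "J (flow_limit u) = 0"
proof (rule antisym)
  show "J (flow_limit u) \<le> 0"
  proof (rule ccontr)
    assume "\<not> ?thesis"
    then obtain c where c: "0 < ereal c" "ereal c < J (flow_limit u)"
      using ereal_dense2[of 0 "J (flow_limit u)"] by (auto simp: not_le)
    have "eventually (\<lambda>t. ereal c < J (u t)) at_top"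
      using lower_semicontinuous_eventually_greater[OF lower_semicontinuous c(2)] flow_converges
      by (rule eventually_compose_filterlim)
    moreover have "eventually (\<lambda>t. energy t \<le> c) at_top"
    proof -
      \<comment> \<open>From this time on, an energy above \<open>c\<close> would have used up the squared norm left at time 1.\<close>
      have "eventually (\<lambda>t. 2 + (norm (u 1))\<^sup>2 / (2 * c) \<le> t) at_top"
        by (rule eventually_ge_at_top)
      then show ?thesis
      proof eventually_elim
        case (elim t)
        have "0 \<le> (norm (u 1))\<^sup>2 / (2 * c)"
          using c(1) by simp
        with elim have "1 < t" by simp
        have "2 * energy t * (t - 1) \<le> 2 * p * energy t * (t - 1)"
          using \<open>1 < t\<close> p_ge_1 energy_nonneg[of t] by (intro mult_right_mono) (auto simp: mult_le_cancel_right1)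
        also have "\<dots> \<le> (norm (u 1))\<^sup>2"
          using norm_square_decrease[of 1 t] \<open>1 < t\<close> zero_le_power2[of "norm (u t)"] by linarith
        also have "\<dots> \<le> 2 * c * (t - 1)"
          using elim c(1) \<open>1 < t\<close> by (simp add: field_simps)
        finally show ?case
          using \<open>1 < t\<close> by simp
      qed
    qed
    ultimately have "eventually (\<lambda>t::real. False) at_top"
      using eventually_gt_at_top[of 0]
      by eventually_elim (auto simp: J_flow)
    then show False by simp
  qed
qed (rule J_nonneg)

lemma inner_null_nonincreasing:
  assumes "J n = 0" "0 \<le> s" "s \<le> t"
  shows "u t \<bullet> n \<le> u s \<bullet> n"
proof (rule nonincreasing_if_right_derivative_nonpos[OF \<open>s \<le> t\<close>])
  show "continuous_on {s..t} (\<lambda>x. u x \<bullet> n)"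
    using assms by (intro continuous_intros continuous_flow) auto
  fix x assume "s < x" "x < t"
  then have "0 < x" using assms by simp
  then have "((\<lambda>x. u x \<bullet> n) has_real_derivative 0) (at x within {x..})"
    using has_real_derivative_inner[OF velocity has_vector_derivative_const[of n], of x]
      subgradient_orthogonal_null[OF subgradient assms(1)] by simp
  then show "\<exists>D\<le>0. ((\<lambda>x. u x \<bullet> n) has_real_derivative D) (at x within {x..})"
    by blast
qed

text \<open>
  Subgradients are orthogonal to the null space, so the component of \<open>u\<close> in the null space is
  conserved and agrees with that of the limit.
\<close>
lemma flow_minus_limit_orthogonal:
  assumes "0 \<le> t"
  shows "u t - flow_limit u \<in> (null_space J)\<^sup>\<bottom>"
proof -
  have "n \<bullet> (u t - flow_limit u) = 0" if n: "J n = 0" for n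
  proof -
    have const: "u s \<bullet> n = u t \<bullet> n" if "t \<le> s" for s
      using inner_null_nonincreasing[OF n assms that] inner_null_nonincreasing[of "- n", OF _ assms that] n
      by (simp add: J_minus)
    have "((\<lambda>s. u s \<bullet> n) \<longlongrightarrow> flow_limit u \<bullet> n) at_top"
      by (intro tendsto_intros flow_converges)
    moreover have "eventually (\<lambda>s. u s \<bullet> n = u t \<bullet> n) at_top"
      using eventually_ge_at_top[of t] by eventually_elim (rule const)
    ultimately have "((\<lambda>s::real. u t \<bullet> n) \<longlongrightarrow> flow_limit u \<bullet> n) at_top"
      by (rule Lim_transform_eventually)
    then have "u t \<bullet> n = flow_limit u \<bullet> n"
      by (simp add: tendsto_const_iff)
    then show ?thesis
      by (simp add: inner_diff_right inner_commute)
  qed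
  then show ?thesis
    by (auto simp: orthogonal_comp_def orthogonal_def null_space_def)
qed

end

section \<open>Decay of the distance to the limit\<close>

text \<open>
  A primitive of \<open>x powr (- p / 2) / 2\<close> on the positive reals. If a positive \<open>y\<close>
  satisfies \<open>y' \<le> - 2 * l * y powr (p / 2)\<close>, as the squared distance to the limit does with \<open>l\<close> the first eigenvalue, then \<open>decay_potential p y\<close>
  decreases at rate at least \<open>l\<close>. The three decay laws are this one fact, solved for \<open>y\<close>.
\<close>
definition decay_potential :: "real \<Rightarrow> real \<Rightarrow> real" where
  "decay_potential p x = (if p = 2 then ln x / 2 else x powr (1 - p / 2) / (2 - p))"

lemma has_real_derivative_decay_potential:
  assumes "0 < x"
  shows "(decay_potential p has_real_derivative x powr (- p / 2) / 2) (at x)"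
proof (cases "p = 2")
  case True
  have "((\<lambda>x. ln x / 2) has_real_derivative inverse x / 2) (at x)"
    by (intro DERIV_cdivide DERIV_ln assms)
  then show ?thesis
    using True assms by (simp add: decay_potential_def[abs_def] powr_neg_one inverse_eq_divide)
next
  case False
  have "((\<lambda>x. x powr (1 - p / 2) / (2 - p)) has_real_derivative
      (1 - p / 2) * x powr (1 - p / 2 - 1) / (2 - p)) (at x)"
    by (intro DERIV_cdivide has_real_derivative_powr assms)
  then have "((\<lambda>x. x powr (1 - p / 2) / (2 - p)) has_real_derivative x powr (- p / 2) / 2) (at x)"
  proof (rule DERIV_cong)
    have "(1 - p / 2) / (2 - p) = 1 / 2"
      using False by (simp add: divide_simps)
    then have "(1 - p / 2) / (2 - p) * x powr (- p / 2) = 1 / 2 * x powr (- p / 2)"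
      by (rule arg_cong)
    then show "(1 - p / 2) * x powr (1 - p / 2 - 1) / (2 - p) = x powr (- p / 2) / 2"
      by simp
  qed
  then show ?thesis
    using False by (simp add: decay_potential_def[abs_def])
qed

lemma continuous_on_decay_potential: "continuous_on {0<..} (decay_potential p)"
  using has_real_derivative_decay_potential[of _ p]
  by (intro continuous_at_imp_continuous_on ballI) (auto dest!: DERIV_isCont)

lemma power2_powr:
  fixes x q :: real
  assumes "0 \<le> x"
  shows "x\<^sup>2 powr q = x powr (2 * q)"
proof -
  have "x\<^sup>2 powr q = (x powr 2) powr q"
    using assms by simp
  then show ?thesis
    by (simp only: powr_powr)
qed

lemma decay_potential_power2:
  assumes "p \<noteq> 2"
  shows "decay_potential p ((norm v)\<^sup>2) = norm v powr (2 - p) / (2 - p)"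
  using assms by (simp add: decay_potential_def power2_powr right_diff_distrib)

context homogeneous_gradient_flow
begin

lemma distance_to_limit_nonincreasing:
  assumes "0 \<le> s" "s \<le> t"
  shows "norm (u t - flow_limit u) \<le> norm (u s - flow_limit u)"
proof -
  have "(norm (u t - flow_limit u))\<^sup>2 \<le> (norm (u s - flow_limit u))\<^sup>2"
  proof (rule nonincreasing_if_right_derivative_nonpos[OF \<open>s \<le> t\<close>])
    show "continuous_on {s..t} (\<lambda>x. (norm (u x - flow_limit u))\<^sup>2)"
      using assms by (intro continuous_intros continuous_flow) auto
    fix x assume "s < x" "x < t"
    with assms have "0 < x" by simp
    then have "0 \<le> \<zeta> x \<bullet> (u x - flow_limit u)"
      using energy_nonneg[of x] p_ge_1 subgradient_orthogonal_null[OF subgradient J_flow_limit, of x]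
      by (simp add: inner_diff_right flow_inner_subgradient)
    then show "\<exists>D\<le>0. ((\<lambda>x. (norm (u x - flow_limit u))\<^sup>2) has_real_derivative D) (at x within {x..})"
      using has_real_derivative_norm_square[OF \<open>0 < x\<close>, of "flow_limit u"]
      by (intro exI[of _ "- 2 * (\<zeta> x \<bullet> (u x - flow_limit u))"]) auto
  qed
  then show ?thesis
    by (rule power2_le_imp_le) simp
qed

lemma first_eigenvalue_nonneg: "0 \<le> first_eigenvalue p J"
  unfolding first_eigenvalue_def
proof (rule INF_greatest)
  fix v :: 'a assume "v \<in> (null_space J)\<^sup>\<bottom> - {0}"
  then show "0 \<le> ereal p * J v / ereal (norm v powr p)"
    using p_ge_1 J_nonneg[of v] by (intro zero_le_divide_ereal mult_nonneg_nonneg) auto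
qed

text \<open>
  The displacement from the limit is orthogonal to the null space and thus admissible in the
  quotient that defines the first eigenvalue. Subtracting the limit from \<open>u t\<close> neither raises \<open>J\<close>
  nor changes the inner product with \<open>\<zeta> t\<close>, so Euler's identity at \<open>u t\<close> bounds the numerator. In
  particular, the first eigenvalue is finite if the flow is away from its limit at some time.
\<close>
lemma first_eigenvalue_le_quotient:
  assumes "0 < t" "u t \<noteq> flow_limit u"
  shows "first_eigenvalue p J
    \<le> ereal (\<zeta> t \<bullet> (u t - flow_limit u) / norm (u t - flow_limit u) powr p)"
proof -
  let ?w = "u t - flow_limit u"
  have "J ?w \<le> J (u t)"
    using J_add_null_le[of "- flow_limit u" "u t"] J_flow_limit by (simp add: J_minus)
  then have "J ?w < \<infinity>"
    by (auto simp: J_flow[OF \<open>0 < t\<close>])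
  then obtain r where r: "J ?w = ereal r"
    by (rule J_finite_if_less_infinity)
  with \<open>J ?w \<le> J (u t)\<close> have "r \<le> energy t"
    by (simp add: J_flow[OF \<open>0 < t\<close>])
  have "first_eigenvalue p J \<le> ereal p * J ?w / ereal (norm ?w powr p)"
    unfolding first_eigenvalue_def using flow_minus_limit_orthogonal[of t] assms
    by (intro INF_lower) auto
  also have "\<dots> = ereal (p * r / norm ?w powr p)"
    using assms by (simp add: r)
  also have "p * r / norm ?w powr p \<le> p * energy t / norm ?w powr p"
    using \<open>r \<le> energy t\<close> p_ge_1 by (intro divide_right_mono mult_left_mono) auto
  also have "p * energy t = \<zeta> t \<bullet> ?w"
    using subgradient_orthogonal_null[OF subgradient J_flow_limit, of t] assms
    by (simp add: inner_diff_right flow_inner_subgradient)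
  finally show ?thesis by simp
qed

lemma decay_potential_estimate:
  assumes "0 < t" "u t \<noteq> flow_limit u" and l: "first_eigenvalue p J = ereal l"
  shows "decay_potential p ((norm (u t - flow_limit u))\<^sup>2) + l * t
    \<le> decay_potential p ((norm (u 0 - flow_limit u))\<^sup>2)"
proof -
  let ?n = "\<lambda>x. (norm (u x - flow_limit u))\<^sup>2"
  let ?g = "\<lambda>x. decay_potential p (?n x) + l * x"
  have pos: "0 < norm (u x - flow_limit u)" if "0 \<le> x" "x \<le> t" for x
    using distance_to_limit_nonincreasing[OF that] assms(2) by auto
  have "?g t \<le> ?g 0"
  proof (rule nonincreasing_if_right_derivative_nonpos[where g = ?g])
    have "continuous_on {0..t} (\<lambda>x. decay_potential p (?n x))"
    proof (rule continuous_on_compose2[OF continuous_on_decay_potential])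
      show "continuous_on {0..t} ?n"
        by (intro continuous_intros continuous_flow) auto
    qed (use pos in auto)
    then show "continuous_on {0..t} ?g"
      by (intro continuous_intros)
  next
    fix x assume x: "0 < x" "x < t"
    let ?w = "u x - flow_limit u"
    have "0 < norm ?w"
      using pos[of x] x by simp
    have "(?g has_real_derivative ?n x powr (- p / 2) / 2 * (- 2 * (\<zeta> x \<bullet> ?w)) + l) (at x within {x..})"
      using x \<open>0 < norm ?w\<close>
      by (intro DERIV_add DERIV_chain2[OF has_real_derivative_decay_potential]
          has_real_derivative_norm_square DERIV_cmult_Id) auto
    moreover have "?n x powr (- p / 2) = 1 / norm ?w powr p"
      by (simp add: power2_powr powr_minus_divide)
    moreover have "l \<le> \<zeta> x \<bullet> ?w / norm ?w powr p"
      using first_eigenvalue_le_quotient[of x] x \<open>0 < norm ?w\<close> l by simp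
    ultimately show "\<exists>D\<le>0. (?g has_real_derivative D) (at x within {x..})"
      by (intro exI[of _ "?n x powr (- p / 2) / 2 * (- 2 * (\<zeta> x \<bullet> ?w)) + l"]) auto
  qed (use assms in auto)
  then show ?thesis by simp
qed

end

lemma not_extinct_before_extinction_time:
  assumes "0 < t" "ereal t < extinction_time u"
  shows "u t \<noteq> flow_limit u"
proof
  assume "u t = flow_limit u"
  with assms(1) have "extinction_time u \<le> ereal t"
    unfolding extinction_time_def by (intro Inf_lower) auto
  with assms(2) show False by simp
qed

theorem proposition2p63:
  fixes p :: real
    and J :: "'a::{real_inner, complete_space} \<Rightarrow> ereal"
    and f :: 'a
    and u :: "real \<Rightarrow> 'a"
  assumes "1 \<le> p"
    and "absolutely_homogeneous p J"
    and "proper_functional J"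
    and "convex_functional J"
    and "lower_semicontinuous J"
    and "f \<in> closure (effective_domain J)"
    and "gradient_flow J f u"
  defines "u_inf \<equiv> flow_limit u"
    and "lambda_1 \<equiv> first_eigenvalue p J"
  shows "\<forall>t. 0 < t \<and> ereal t < extinction_time u \<longrightarrow>
    (p < 2 \<longrightarrow>
       ereal (norm (u t - u_inf) powr (2 - p))
         \<le> ereal (norm (f - u_inf) powr (2 - p)) - ereal (2 - p) * lambda_1 * ereal t) \<and>
    (p = 2 \<longrightarrow>
       ereal ((norm (u t - u_inf))\<^sup>2)
         \<le> ereal ((norm (f - u_inf))\<^sup>2) * exp_ereal (ereal (- 2) * lambda_1 * ereal t)) \<and>
    (p > 2 \<longrightarrow>
       ereal (norm (u t - u_inf) powr (p - 2))
         \<le> 1 / (ereal (norm (f - u_inf) powr (2 - p)) + ereal (p - 2) * lambda_1 * ereal t))"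
proof (intro allI impI)
  fix t :: real
  assume "0 < t \<and> ereal t < extinction_time u"
  then have "0 < t" and neq: "u t \<noteq> u_inf"
    using not_extinct_before_extinction_time by (auto simp: u_inf_def)
  have "\<forall>s. \<exists>\<zeta>. 0 < s \<longrightarrow> \<zeta> \<in> subdifferential J (u s) \<and> (u has_vector_derivative - \<zeta>) (at s within {s..})"
    using assms(7) unfolding gradient_flow_def is_arg_min_def by (metis minus_minus)
  then obtain \<zeta> where \<zeta>: "\<And>s. 0 < s \<Longrightarrow> \<zeta> s \<in> subdifferential J (u s)"
    "\<And>s. 0 < s \<Longrightarrow> (u has_vector_derivative - \<zeta> s) (at s within {s..})"
    by metis
  interpret homogeneous_gradient_flow p J u \<zeta>
    using assms(1-5,7) \<zeta> by unfold_locales (auto simp: gradient_flow_def)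
  \<comment> \<open>From here on the extended arithmetic of the claim is real arithmetic.\<close>
  obtain l where l: "lambda_1 = ereal l" and "0 \<le> l"
    using first_eigenvalue_nonneg first_eigenvalue_le_quotient[OF \<open>0 < t\<close>] neq
    unfolding lambda_1_def u_inf_def by (cases "first_eigenvalue p J") auto
  define a where "a = norm (u t - u_inf)"
  define b where "b = norm (f - u_inf)"
  have "u 0 = f"
    using assms(7) by (simp add: gradient_flow_def)
  then have est: "decay_potential p (a\<^sup>2) + l * t \<le> decay_potential p (b\<^sup>2)"
    using decay_potential_estimate[of t l] \<open>0 < t\<close> neq l
    by (simp add: a_def b_def u_inf_def lambda_1_def)
  have "0 < a"
    using neq by (simp add: a_def)
  have "a \<le> b"
    using distance_to_limit_nonincreasing[of 0 t] \<open>0 < t\<close> \<open>u 0 = f\<close> by (simp add: a_def b_def u_inf_def)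
  with \<open>0 < a\<close> have "0 < b" by simp
  have est': "a powr (2 - p) / (2 - p) + l * t \<le> b powr (2 - p) / (2 - p)" if "p \<noteq> 2"
    using est decay_potential_power2[OF that, of "u t - u_inf"] decay_potential_power2[OF that, of "f - u_inf"]
    by (simp add: a_def b_def)
  show "(p < 2 \<longrightarrow>
       ereal (norm (u t - u_inf) powr (2 - p))
         \<le> ereal (norm (f - u_inf) powr (2 - p)) - ereal (2 - p) * lambda_1 * ereal t) \<and>
    (p = 2 \<longrightarrow>
       ereal ((norm (u t - u_inf))\<^sup>2)
         \<le> ereal ((norm (f - u_inf))\<^sup>2) * exp_ereal (ereal (- 2) * lambda_1 * ereal t)) \<and>
    (p > 2 \<longrightarrow>
       ereal (norm (u t - u_inf) powr (p - 2))
         \<le> 1 / (ereal (norm (f - u_inf) powr (2 - p)) + ereal (p - 2) * lambda_1 * ereal t))"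
    unfolding a_def[symmetric] b_def[symmetric] l
  proof (intro conjI impI)
    assume "p < 2"
    then have "a powr (2 - p) \<le> b powr (2 - p) - (2 - p) * l * t"
      using est' pos_divide_le_eq[of "2 - p" "a powr (2 - p) - b powr (2 - p)" "- (l * t)"]
      by (simp add: diff_divide_distrib algebra_simps)
    then show "ereal (a powr (2 - p)) \<le> ereal (b powr (2 - p)) - ereal (2 - p) * ereal l * ereal t"
      by simp
  next
    assume "p = 2"
    then have "ln (a\<^sup>2) \<le> ln (b\<^sup>2) - 2 * l * t"
      using est by (simp add: decay_potential_def)
    then have "exp (ln (a\<^sup>2)) \<le> exp (ln (b\<^sup>2) - 2 * l * t)"
      by simp
    then have "a\<^sup>2 \<le> b\<^sup>2 * exp (- 2 * l * t)"
      using \<open>0 < a\<close> \<open>0 < b\<close> by (simp add: exp_diff exp_minus divide_inverse)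
    then show "ereal (a\<^sup>2) \<le> ereal (b\<^sup>2) * exp_ereal (ereal (- 2) * ereal l * ereal t)"
      by (simp add: exp_ereal_def)
  next
    assume "2 < p"
    then have le: "b powr (2 - p) + (p - 2) * l * t \<le> a powr (2 - p)"
      using est' neg_divide_le_eq[of "2 - p" "a powr (2 - p) - b powr (2 - p)" "- (l * t)"]
      by (simp add: diff_divide_distrib algebra_simps)
    have pos: "0 < b powr (2 - p) + (p - 2) * l * t"
      using \<open>2 < p\<close> \<open>0 \<le> l\<close> \<open>0 < t\<close> \<open>0 < b\<close> by (intro add_pos_nonneg) auto
    have "a powr (p - 2) = 1 / a powr (2 - p)"
      using powr_minus_divide[of a "2 - p"] by simp
    also have "\<dots> \<le> 1 / (b powr (2 - p) + (p - 2) * l * t)"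
      using le pos by (intro frac_le) auto
    finally show "ereal (a powr (p - 2)) \<le> 1 / (ereal (b powr (2 - p)) + ereal (p - 2) * ereal l * ereal t)"
      using pos by (simp add: one_ereal_def)
  qed
qed

end
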